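(* If $G$ is a connected graph and $e$ is any edge of $G$, then $b_{\rm g}(G) \le b_{\rm g}(G-e) \le b_{\rm g}(G)+2$ and $b_{\rm g}'(G) \le b_{\rm g}'(G-e) \le b_{\rm g}'(G)+2$.
   Context: $G-e$ denotes the graph obtained from $G$ by deleting the edge $e$ (keeping all vertices). The burning game on a finite simple graph $G$ is played by two players, Burner and Staller. Each vertex is either burned or unburned, and once burned it stays burned. In round 1 the starting player chooses one unburned vertex and burns it (selection phase only). Each round $t \ge 2$ consists of a spreading phase, in which every unburned vertex with a burned neighbor becomes burned, followed, if unburned vertices remain, by a selection phase in which the player whose turn it is burns one unburned vertex; the two players make the selections alternately. The game ends in the first round in which all vertices are burned (this may happen right after a spreading phase), and its length is the number of that round. Burner wants to minimize the length and Staller to maximize it. $b_{\rm g}(G)$ is the length under optimal play when Burner makes the first selection, and $b_{\rm g}'(G)$ is the length under optimal play when Staller makes the first selection. *)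

theory Defs
  imports "Graph_Theory.Pair_Digraph" "Graph_Theory.Digraph_Component"
begin

text \<open>
  A finite simple graph is a \<^locale>\<open>pair_graph\<close>: a finite loop-free symmetric digraph whose arcs are
  pairs of vertices. An undirected edge consists of two opposite arcs, so deleting the edge
  given by an arc \<open>e\<close> removes both.
\<close>

definition delete_edge :: "'a pair_pre_digraph \<Rightarrow> 'a \<times> 'a \<Rightarrow> 'a pair_pre_digraph" where
  "delete_edge G e = G\<lparr> parcs := parcs G - {e, prod.swap e} \<rparr>"

datatype player = Burner | Staller

definition spread :: "'a pair_pre_digraph \<Rightarrow> 'a set \<Rightarrow> 'a set" where
  "spread G B = B \<union> {v \<in> pverts G. \<exists>u\<in>B. (u, v) \<in> parcs G}"

text \<open>
  The number of further rounds under optimal play when, at the end of some round, \<open>B\<close> is the set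
  of burned vertices and \<open>p\<close> makes the next selection (if there is one). The value on infinite
  graphs is arbitrary; the finiteness guard only serves termination.
\<close>

function rounds_left :: "'a pair_pre_digraph \<Rightarrow> player \<Rightarrow> 'a set \<Rightarrow> nat" where
  "rounds_left G p B =
     (if infinite (pverts G) \<or> pverts G \<subseteq> B then 0
      else if pverts G \<subseteq> spread G B then 1
      else 1 + (case p of
          Burner \<Rightarrow> Min ((\<lambda>v. rounds_left G Staller (insert v (spread G B))) ` (pverts G - spread G B))
        | Staller \<Rightarrow> Max ((\<lambda>v. rounds_left G Burner (insert v (spread G B))) ` (pverts G - spread G B))))"
  by pat_completeness auto
termination
proof (relation "measure (\<lambda>(G, p, B). card (pverts G - B))")
  have decrease: "card (pverts G - insert v (spread G B)) < card (pverts G - B)"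
    if "\<not> (infinite (pverts G) \<or> pverts G \<subseteq> B)" "v \<in> pverts G - spread G B"
    for G :: "'a pair_pre_digraph" and v B
    using that by (intro psubset_card_mono) (auto simp: spread_def)
  show "((G, Staller, insert v (spread G B)), (G, p, B))
      \<in> measure (\<lambda>(G, p, B). card (pverts G - B))"
    if "\<not> (infinite (pverts G) \<or> pverts G \<subseteq> B)" "v \<in> pverts G - spread G B"
    for G :: "'a pair_pre_digraph" and p B v
    using decrease[OF that] by simp
  show "((G, Burner, insert v (spread G B)), (G, p, B))
      \<in> measure (\<lambda>(G, p, B). card (pverts G - B))"
    if "\<not> (infinite (pverts G) \<or> pverts G \<subseteq> B)" "v \<in> pverts G - spread G B"
    for G :: "'a pair_pre_digraph" and p B v
    using decrease[OF that] by simp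
qed simp

declare rounds_left.simps [simp del]

text \<open>
  In round 1 there is no spreading phase; the starting player burns an arbitrary vertex.
\<close>

definition burning_game_length :: "'a pair_pre_digraph \<Rightarrow> nat" ("b\<^sub>g") where
  "b\<^sub>g G = 1 + Min ((\<lambda>v. rounds_left G Staller {v}) ` pverts G)"

definition burning_game_length_Staller_start :: "'a pair_pre_digraph \<Rightarrow> nat" ("b\<^sub>g''") where
  "b\<^sub>g' G = 1 + Max ((\<lambda>v. rounds_left G Burner {v}) ` pverts G)"

end

(* Burning more vertices or having more edges never slows the game down, so Burner loses at most
   one round by a wasted move. The games on G and G - e agree round by round as long as both or
   none of the endpoints of e are burned. As soon as exactly one endpoint is burned, Burner spends
   his next move on the other one: from then on e is irrelevant, and the detour costs at most two
   rounds, whoever is to move. *)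
theory Submission
  imports Defs
begin

section \<open>Unfolding the recursion: legal moves give bounds, optimal moves attain them\<close>

lemma rounds_left_eq_0: "pverts G \<subseteq> B \<Longrightarrow> rounds_left G p B = 0"
  by (simp add: rounds_left.simps)

lemma rounds_left_eq_1:
  "finite (pverts G) \<Longrightarrow> \<not> pverts G \<subseteq> B \<Longrightarrow> pverts G \<subseteq> spread G B \<Longrightarrow> rounds_left G p B = 1"
  by (simp add: rounds_left.simps)

lemma subset_spread: "B \<subseteq> spread G B"
  by (auto simp: spread_def)

lemma spread_mono:
  "pverts H = pverts G \<Longrightarrow> parcs G \<subseteq> parcs H \<Longrightarrow> B \<subseteq> B' \<Longrightarrow> spread G B \<subseteq> spread H B'"
  by (auto simp: spread_def)

lemma rounds_left_Burner:
  assumes "finite (pverts G)" "\<not> pverts G \<subseteq> spread G B"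
  shows "rounds_left G Burner B =
    Suc (Min ((\<lambda>v. rounds_left G Staller (insert v (spread G B))) ` (pverts G - spread G B)))"
proof -
  have "\<not> pverts G \<subseteq> B"
    using assms(2) subset_spread[of B G] by auto
  then show ?thesis
    using assms by (subst rounds_left.simps) simp
qed

lemma rounds_left_Staller:
  assumes "finite (pverts G)" "\<not> pverts G \<subseteq> spread G B"
  shows "rounds_left G Staller B =
    Suc (Max ((\<lambda>v. rounds_left G Burner (insert v (spread G B))) ` (pverts G - spread G B)))"
proof -
  have "\<not> pverts G \<subseteq> B"
    using assms(2) subset_spread[of B G] by auto
  then show ?thesis
    using assms by (subst rounds_left.simps) simp
qed

lemma rounds_left_Burner_le:
  assumes "finite (pverts G)" "v \<in> pverts G - spread G B"
  shows "rounds_left G Burner B \<le> Suc (rounds_left G Staller (insert v (spread G B)))"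
  using assms by (subst rounds_left_Burner) (auto intro!: Min_le)

lemma rounds_left_Staller_ge:
  assumes "finite (pverts G)" "v \<in> pverts G - spread G B"
  shows "Suc (rounds_left G Burner (insert v (spread G B))) \<le> rounds_left G Staller B"
  using assms by (subst rounds_left_Staller) (auto intro!: Max_ge)

lemma rounds_left_Burner_obtain:
  assumes "finite (pverts G)" "\<not> pverts G \<subseteq> spread G B"
  obtains v where "v \<in> pverts G - spread G B"
    "rounds_left G Burner B = Suc (rounds_left G Staller (insert v (spread G B)))"
proof -
  have "Min ((\<lambda>v. rounds_left G Staller (insert v (spread G B))) ` (pverts G - spread G B))
      \<in> (\<lambda>v. rounds_left G Staller (insert v (spread G B))) ` (pverts G - spread G B)"
    using assms by (intro Min_in) auto
  then show thesis
    using that rounds_left_Burner[OF assms] by auto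
qed

lemma rounds_left_Staller_obtain:
  assumes "finite (pverts G)" "\<not> pverts G \<subseteq> spread G B"
  obtains v where "v \<in> pverts G - spread G B"
    "rounds_left G Staller B = Suc (rounds_left G Burner (insert v (spread G B)))"
proof -
  have "Max ((\<lambda>v. rounds_left G Burner (insert v (spread G B))) ` (pverts G - spread G B))
      \<in> (\<lambda>v. rounds_left G Burner (insert v (spread G B))) ` (pverts G - spread G B)"
    using assms by (intro Max_in) auto
  then show thesis
    using that rounds_left_Staller[OF assms] by auto
qed

lemma rounds_left_pos:
  assumes "finite (pverts G)" "\<not> pverts G \<subseteq> B"
  shows "1 \<le> rounds_left G p B"
  using assms by (subst rounds_left.simps) simp

section \<open>Comparing positions: strategy transfer, monotonicity, change of turn\<close>

text \<open>
  Strategy transfer: Burner copies his move \<open>v\<close> on \<open>G\<close> to \<open>H\<close>, or plays an arbitrary \<open>w\<close> if \<open>v\<close>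
  is already burned there; Staller's moves on \<open>H\<close> are legal on \<open>G\<close>.
\<close>

lemma rounds_left_transfer:
  assumes fin: "finite (pverts G)" and verts: "pverts H = pverts G"
    and sub: "B \<subseteq> B'" and spread_sub: "spread G B \<subseteq> spread H B'"
    and step: "\<And>q v w. v \<in> pverts G - spread G B \<Longrightarrow> w \<in> pverts G - spread H B' \<Longrightarrow>
      insert v (spread G B) \<subseteq> insert w (spread H B') \<Longrightarrow>
      rounds_left H q (insert w (spread H B')) \<le> rounds_left G q (insert v (spread G B)) + c"
  shows "rounds_left H p B' \<le> rounds_left G p B + c"
proof (cases "pverts G \<subseteq> spread H B'")
  case True
  show ?thesis
  proof (cases "pverts G \<subseteq> B'")
    case True
    then show ?thesis
      using verts by (simp add: rounds_left_eq_0)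
  next
    \<comment> \<open>A vertex missing from \<open>B'\<close> is also missing from \<open>B\<close>,
      so the game on \<open>G\<close> needs at least the single spreading round that finishes
      \<open>H\<close>.\<close>
    case False
    then have "\<not> pverts G \<subseteq> B"
      using sub by auto
    then have "1 \<le> rounds_left G p B"
      using fin by (rule rounds_left_pos[rotated])
    moreover have "rounds_left H p B' = 1"
      using fin verts False True by (intro rounds_left_eq_1) auto
    ultimately show ?thesis
      by simp
  qed
next
  case notH: False
  then have notG: "\<not> pverts G \<subseteq> spread G B"
    using spread_sub by auto
  show ?thesis
  proof (cases p)
    case Burner
    obtain v where v: "v \<in> pverts G - spread G B"
      "rounds_left G Burner B = Suc (rounds_left G Staller (insert v (spread G B)))"
      using rounds_left_Burner_obtain[OF fin notG] .
    obtain w where w: "w \<in> pverts G - spread H B'" "v \<in> insert w (spread H B')"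
      using v(1) notH by blast
    have "rounds_left H Burner B' \<le> Suc (rounds_left H Staller (insert w (spread H B')))"
      using fin verts w(1) by (intro rounds_left_Burner_le) auto
    also have "\<dots> \<le> Suc (rounds_left G Staller (insert v (spread G B)) + c)"
      using step[OF v(1) w(1)] w(2) spread_sub by auto
    finally show ?thesis
      using v(2) Burner by simp
  next
    case Staller
    have "finite (pverts H)" "\<not> pverts H \<subseteq> spread H B'"
      using fin verts notH by simp_all
    then obtain w where w: "w \<in> pverts H - spread H B'"
      "rounds_left H Staller B' = Suc (rounds_left H Burner (insert w (spread H B')))"
      by (rule rounds_left_Staller_obtain)
    then have w': "w \<in> pverts G - spread G B" "w \<in> pverts G - spread H B'"
      using verts spread_sub by auto
    have "rounds_left H Burner (insert w (spread H B'))
        \<le> rounds_left G Burner (insert w (spread G B)) + c"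
      using step[OF w'] spread_sub by auto
    then show ?thesis
      using rounds_left_Staller_ge[OF fin w'(1)] w(2) Staller by simp
  qed
qed

text \<open>The number of unburned vertices is the measure for all inductions over positions
  below.\<close>

lemma card_unburned_decreases:
  assumes "finite V" "v \<in> V - spread G B"
  shows "card (V - insert v (spread G B)) < card (V - B)"
  using assms subset_spread[of B G] by (intro psubset_card_mono) auto

text \<open>Strategy transfer with slack 0: inclusion of the burned sets survives spreading along
  the larger arc set and the transferred move, so it is an invariant of the parallel play.\<close>

lemma rounds_left_mono:
  assumes "finite (pverts G)" "pverts H = pverts G" "parcs G \<subseteq> parcs H" "B \<subseteq> B'"
  shows "rounds_left H p B' \<le> rounds_left G p B"
  using assms(4)
proof (induction "card (pverts G - B)" arbitrary: B B' p rule: less_induct)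
  case less
  have "rounds_left H p B' \<le> rounds_left G p B + 0"
  proof (rule rounds_left_transfer)
    show "spread G B \<subseteq> spread H B'"
      using assms less.prems by (intro spread_mono)
    fix q v w
    assume "v \<in> pverts G - spread G B" "insert v (spread G B) \<subseteq> insert w (spread H B')"
    then show "rounds_left H q (insert w (spread H B'))
        \<le> rounds_left G q (insert v (spread G B)) + 0"
      using less.hyps card_unburned_decreases[OF assms(1)] by simp
  qed (use assms less.prems in auto)
  then show ?case
    by simp
qed

text \<open>After one round with an optimal move of \<open>p\<close>, the turn is with
  \<open>q\<close> and the burned set contains \<open>B\<close>; by monotonicity at most
  \<open>rounds_left G q B\<close> rounds follow.\<close>

lemma rounds_left_change_player:
  assumes "finite (pverts G)"
  shows "rounds_left G p B \<le> Suc (rounds_left G q B)"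
proof (cases "pverts G \<subseteq> spread G B")
  case True
  then have "rounds_left G p B \<le> 1"
    using assms by (cases "pverts G \<subseteq> B") (simp_all add: rounds_left_eq_0 rounds_left_eq_1)
  then show ?thesis
    by simp
next
  case False
  have mono: "rounds_left G r (insert v (spread G B)) \<le> rounds_left G r B" for r v
    using assms subset_spread[of B G] by (intro rounds_left_mono) auto
  show ?thesis
  proof (cases "p = q")
    case False
    then consider "p = Burner" "q = Staller" | "p = Staller" "q = Burner"
      by (cases p; cases q) auto
    then show ?thesis
    proof cases
      case 1
      then show ?thesis
        using rounds_left_Burner_obtain[OF assms \<open>\<not> pverts G \<subseteq> spread G B\<close>] mono
        by (metis Suc_le_mono)
    next
      case 2
      then show ?thesis
        using rounds_left_Staller_obtain[OF assms \<open>\<not> pverts G \<subseteq> spread G B\<close>] mono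
        by (metis Suc_le_mono)
    qed
  qed simp
qed

section \<open>Effect of deleting an edge on a position\<close>

lemma pverts_delete_edge [simp]: "pverts (delete_edge G e) = pverts G"
  by (simp add: delete_edge_def)

lemma parcs_delete_edge: "parcs (delete_edge G e) = parcs G - {e, prod.swap e}"
  by (simp add: delete_edge_def)

text \<open>An edge matters in a spreading phase only if it leads from a burned to an unburned
  endpoint.\<close>

lemma spread_delete_edge:
  "x \<in> B \<longleftrightarrow> y \<in> B \<Longrightarrow> spread (delete_edge G (x, y)) B = spread G B"
  by (auto simp: spread_def parcs_delete_edge)

text \<open>Burned endpoints stay burned, so the spreading phases coincide for the rest of the game
  and every move can be copied.\<close>

lemma rounds_left_delete_edge_burned:
  assumes "finite (pverts G)" "x \<in> B" "y \<in> B"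
  shows "rounds_left (delete_edge G (x, y)) p B \<le> rounds_left G p B"
  using assms(2,3)
proof (induction "card (pverts G - B)" arbitrary: B p rule: less_induct)
  case less
  have same: "spread (delete_edge G (x, y)) B = spread G B"
    using less.prems by (intro spread_delete_edge) simp
  have "rounds_left (delete_edge G (x, y)) p B \<le> rounds_left G p B + 0"
  proof (rule rounds_left_transfer)
    fix q v w
    assume v: "v \<in> pverts G - spread G B"
      and "insert v (spread G B) \<subseteq> insert w (spread (delete_edge G (x, y)) B)"
    \<comment> \<open>The two spread sets are equal and do not contain \<open>v\<close>, so the
      inclusion leaves no other choice for \<open>w\<close>.\<close>
    then have "w = v"
      using same by auto
    then show "rounds_left (delete_edge G (x, y)) q (insert w (spread (delete_edge G (x, y)) B))
        \<le> rounds_left G q (insert v (spread G B)) + 0"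
      using less.hyps[OF card_unburned_decreases[OF assms(1) v]] less.prems
        subset_spread[of B G] same by auto
  qed (use assms(1) same in auto)
  then show ?case
    by simp
qed

text \<open>One round lets Burner complete the pair of endpoints. Staller then moves from a superset
  of \<open>B\<close> in which the edge is irrelevant, hence the change of player on the
  right.\<close>

lemma rounds_left_delete_edge_Burner:
  assumes fin: "finite (pverts G)" and "x \<in> pverts G" "y \<in> pverts G" and "x \<in> B \<or> y \<in> B"
  shows "rounds_left (delete_edge G (x, y)) Burner B \<le> Suc (rounds_left G Staller B)"
proof (cases "pverts G \<subseteq> spread (delete_edge G (x, y)) B")
  case True
  then have "rounds_left (delete_edge G (x, y)) Burner B \<le> 1"
    using fin by (cases "pverts G \<subseteq> B") (simp_all add: rounds_left_eq_0 rounds_left_eq_1)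
  then show ?thesis
    by simp
next
  case False
  let ?H = "delete_edge G (x, y)"
  \<comment> \<open>At most one endpoint is unburned after spreading; \<open>w\<close> is that
    endpoint, or an arbitrary unburned vertex if there is none.\<close>
  obtain w where w: "w \<in> pverts G - spread ?H B" "{x, y} \<subseteq> insert w (spread ?H B)"
    using assms False subset_spread[of B ?H] by blast
  have "rounds_left ?H Burner B \<le> Suc (rounds_left ?H Staller (insert w (spread ?H B)))"
    using fin w(1) by (intro rounds_left_Burner_le) auto
  also have "\<dots> \<le> Suc (rounds_left G Staller (insert w (spread ?H B)))"
    using fin w(2) by (simp add: rounds_left_delete_edge_burned)
  also have "\<dots> \<le> Suc (rounds_left G Staller B)"
    using fin subset_spread[of B ?H] by (auto intro!: rounds_left_mono)
  finally show ?thesis .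
qed

text \<open>One round pays for Burner's move on the other endpoint, which shifts the turn; the
  second pays for shifting it back, in \<open>G\<close> if Burner is to move and in the graph
  without the edge if Staller is.\<close>

lemma rounds_left_delete_edge_half_burned:
  assumes fin: "finite (pverts G)" and xy: "x \<in> pverts G" "y \<in> pverts G"
    and burned: "x \<in> B \<or> y \<in> B"
  shows "rounds_left (delete_edge G (x, y)) p B \<le> rounds_left G p B + 2"
proof (cases p)
  case Burner
  have "rounds_left (delete_edge G (x, y)) Burner B \<le> Suc (rounds_left G Staller B)"
    using assms by (rule rounds_left_delete_edge_Burner)
  also have "\<dots> \<le> Suc (Suc (rounds_left G Burner B))"
    using rounds_left_change_player[OF fin] by simp
  finally show ?thesis
    using Burner by simp
next
  case Staller
  have "rounds_left (delete_edge G (x, y)) Staller B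
      \<le> Suc (rounds_left (delete_edge G (x, y)) Burner B)"
    using fin by (intro rounds_left_change_player) simp
  also have "\<dots> \<le> Suc (Suc (rounds_left G Staller B))"
    using rounds_left_delete_edge_Burner[OF assms] by simp
  finally show ?thesis
    using Staller by simp
qed

text \<open>While both endpoints are unburned, spreading agrees and moves are copied without loss.
  The slack 2 is carried along unchanged and spent only once, when an endpoint has been
  burned.\<close>

lemma rounds_left_delete_edge_le:
  assumes fin: "finite (pverts G)" and xy: "x \<in> pverts G" "y \<in> pverts G"
  shows "rounds_left (delete_edge G (x, y)) p B \<le> rounds_left G p B + 2"
proof (induction "card (pverts G - B)" arbitrary: B p rule: less_induct)
  case less
  show ?case
  proof (cases "x \<in> B \<or> y \<in> B")
    case True
    with assms show ?thesis
      by (rule rounds_left_delete_edge_half_burned)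
  next
    case False
    then have same: "spread (delete_edge G (x, y)) B = spread G B"
      by (intro spread_delete_edge) simp
    show ?thesis
    proof (rule rounds_left_transfer)
      fix q v w
      assume v: "v \<in> pverts G - spread G B"
        and "insert v (spread G B) \<subseteq> insert w (spread (delete_edge G (x, y)) B)"
      then have "w = v"
        using same by auto
      then show "rounds_left (delete_edge G (x, y)) q (insert w (spread (delete_edge G (x, y)) B))
          \<le> rounds_left G q (insert v (spread G B)) + 2"
        using less.hyps[OF card_unburned_decreases[OF fin v]] same by simp
    qed (use fin same in auto)
  qed
qed

section \<open>From positions to the whole game: optimizing the first selection\<close>

lemma Min_image_le_add:
  fixes f g :: "'a \<Rightarrow> nat"
  assumes "finite A" "A \<noteq> {}" "\<And>a. a \<in> A \<Longrightarrow> f a \<le> g a + c"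
  shows "Min (f ` A) \<le> Min (g ` A) + c"
proof -
  have "Min (g ` A) \<in> g ` A"
    using assms by (intro Min_in) auto
  then obtain a where "a \<in> A" "Min (g ` A) = g a"
    by auto
  moreover have "Min (f ` A) \<le> f a"
    using assms(1) \<open>a \<in> A\<close> by simp
  ultimately show ?thesis
    using assms(3)[of a] by simp
qed

lemma Max_image_le_add:
  fixes f g :: "'a \<Rightarrow> nat"
  assumes "finite A" "A \<noteq> {}" "\<And>a. a \<in> A \<Longrightarrow> f a \<le> g a + c"
  shows "Max (f ` A) \<le> Max (g ` A) + c"
proof -
  have "Max (f ` A) \<in> f ` A"
    using assms by (intro Max_in) auto
  then obtain a where "a \<in> A" "Max (f ` A) = f a"
    by auto
  moreover have "g a \<le> Max (g ` A)"
    using assms(1) \<open>a \<in> A\<close> by simp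
  ultimately show ?thesis
    using assms(3)[of a] by simp
qed

theorem theorem2p6:
  fixes G :: "'a pair_pre_digraph" and e :: "'a \<times> 'a"
  assumes "pair_graph G"
    and "connected (with_proj G)"
    and "e \<in> parcs G"
  shows "b\<^sub>g G \<le> b\<^sub>g (delete_edge G e) \<and> b\<^sub>g (delete_edge G e) \<le> b\<^sub>g G + 2 \<and>
         b\<^sub>g' G \<le> b\<^sub>g' (delete_edge G e) \<and> b\<^sub>g' (delete_edge G e) \<le> b\<^sub>g' G + 2"
proof -
  interpret pair_graph G
    by (rule assms(1))
  obtain x y where e: "e = (x, y)"
    by (cases e)
  have fin: "finite (pverts G)" and xy: "x \<in> pverts G" "y \<in> pverts G"
    using assms(3) e in_arcsD1 in_arcsD2 by auto
  then have ne: "pverts G \<noteq> {}"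
    by auto
  \<comment> \<open>The summand 0 gives this bound the shape of the \<open>Min\<close> and
    \<open>Max\<close> comparisons, so that they serve both directions.\<close>
  have lower: "rounds_left G p B \<le> rounds_left (delete_edge G e) p B + 0" for p B
    using fin by (auto intro!: rounds_left_mono simp: parcs_delete_edge)
  have upper: "rounds_left (delete_edge G e) p B \<le> rounds_left G p B + 2" for p B
    unfolding e using fin xy by (rule rounds_left_delete_edge_le)
  show ?thesis
    using Min_image_le_add[OF fin ne lower] Min_image_le_add[OF fin ne upper]
      Max_image_le_add[OF fin ne lower] Max_image_le_add[OF fin ne upper]
    unfolding burning_game_length_def burning_game_length_Staller_start_def
    by simp
qed

end
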